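(* Fix $\Gamma z_0\in\mathcal M$. Let $\{y_n\}_{n\in\mathbb N}$ be positive numbers with $y_n\asymp 1/(n^2\log^\beta n)$ for some fixed $0<\beta<2$. Then for Lebesgue-almost every $x\in\mathbb R/\mathbb Z$, $$\limsup_{n\to\infty}\frac{\inf_{\Gamma z\in\mathcal R_n(x,y_n)}d_{\mathcal M}(\Gamma z_0,\Gamma z)}{\log\log n}\ge\min\{\beta,2-\beta\}.$$
   Context: $\mathcal M=\Gamma\backslash\mathbb H$ with $\Gamma=\mathrm{SL}_2(\mathbb Z)$, and $d_{\mathcal M}(\Gamma z_1,\Gamma z_2)=\inf_{\gamma\in\Gamma}d_{\mathbb H}(\gamma z_1,z_2)$, with $d_{\mathbb H}$ the hyperbolic distance for the metric $|dz|/\mathrm{Im}(z)$. $\mathcal R_n(x,y)=\{\Gamma(x+\tfrac jn+iy):0\le j\le n-1\}$. $A\asymp B$ means $A\ll B\ll A$. *)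

theory Defs
  imports "HOL-Analysis.Analysis"
begin

definition upper_half :: "complex set" where
  "upper_half = {z. Im z > 0}"

text \<open>Hyperbolic distance for the metric |dz|/Im z.\<close>
definition hdist :: "complex \<Rightarrow> complex \<Rightarrow> real" where
  "hdist z w = arcosh (1 + (cmod (z - w))\<^sup>2 / (2 * Im z * Im w))"

definition SL2Z :: "(int \<times> int \<times> int \<times> int) set" where
  "SL2Z = {(a,b,c,d). a * d - b * c = 1}"

definition moebius_act :: "int \<times> int \<times> int \<times> int \<Rightarrow> complex \<Rightarrow> complex" where
  "moebius_act g z = (case g of (a,b,c,d) \<Rightarrow>
      (of_int a * z + of_int b) / (of_int c * z + of_int d))"

definition dM :: "complex \<Rightarrow> complex \<Rightarrow> real" where
  "dM z1 z2 = (INF g\<in>SL2Z. hdist (moebius_act g z1) z2)"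

text \<open>Representatives of the points of R_n(x,y).\<close>
definition Rn :: "nat \<Rightarrow> real \<Rightarrow> real \<Rightarrow> complex set" where
  "Rn n x y = {Complex (x + real j / real n) y | j. j < n}"

end

theory Submission
  imports Defs "HOL-Analysis.Kronecker_Approximation_Theorem" "HOL-Real_Asymp.Real_Asymp"
begin

text \<open>
  If \<open>x\<close> is within \<open>\<delta>\<close> of a fraction \<open>a/n\<close>, reduced or not, then every point \<open>x + j/n + i y\<close> is within
  horizontal distance \<open>\<delta>\<close> of \<open>(a+j)/n\<close>, so all of them lie simultaneously at height at least
  \<open>y / (n\<^sup>2 (y\<^sup>2 + \<delta>\<^sup>2))\<close> in the cusp. With \<open>y \<asymp> 1/(n\<^sup>2 log\<^sup>\<beta> n)\<close> and \<open>\<delta>\<close> about \<open>1/(n\<^sup>2 log n)\<close> this height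
  is about \<open>(log n)\<close> to the power \<open>min \<beta> (2 - \<beta>)\<close>.

  That almost every \<open>x\<close> has such approximations for infinitely many \<open>n\<close> is, up to \<open>log log\<close> factors, the
  divergence half of Khinchine's theorem. At the sparse scales \<open>Q = k!\<close> Dirichlet's theorem provides a
  positive proportion of \<open>Q\<^sup>2 |I|\<close> distinct fractions with denominator in \<open>(Q/8, Q]\<close> in any interval \<open>I\<close>,
  and distinct ones are \<open>1/Q\<^sup>2\<close> apart. Hence the neighbourhoods of radius \<open>1/(2 k Q\<^sup>2)\<close> have relative
  measure about \<open>1/k\<close> in \<open>I\<close> and are quasi-independent. A second moment estimate gives their union over
  \<open>k \<ge> K\<close> at least a fixed proportion of every interval, hence full measure.
\<close>

section \<open>Fractions with denominators of a given size\<close>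

text \<open>Cutting the interval into cells of length \<open>e\<close>, a separated set has at most
  one point in each; the floor is the index of the cell.\<close>

lemma card_separated_le:
  fixes T :: "real set"
  assumes T: "T \<subseteq> {a..b}" and ab: "a \<le> b" and e: "e > 0"
    and sep: "\<And>s t. s \<in> T \<Longrightarrow> t \<in> T \<Longrightarrow> s \<noteq> t \<Longrightarrow> e \<le> \<bar>s - t\<bar>"
  shows "finite T" "real (card T) \<le> 1 + (b - a) / e"
proof -
  define f where "f = (\<lambda>t. \<lfloor>(t - a) / e\<rfloor>)"
  have inj: "inj_on f T"
  proof (rule inj_onI, rule ccontr)
    fix s t assume st: "s \<in> T" "t \<in> T" "f s = f t" "s \<noteq> t"
    have "\<bar>(s - a) / e - (t - a) / e\<bar> < 1"
      using st(3) unfolding f_def by linarith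
    moreover have "(s - a) / e - (t - a) / e = (s - t) / e"
      by (simp add: diff_divide_distrib)
    ultimately have "\<bar>s - t\<bar> < e" using e by (simp add: abs_divide)
    then show False using sep[of s t] st by simp
  qed
  have sub: "f ` T \<subseteq> {0..\<lfloor>(b - a) / e\<rfloor>}"
  proof
    fix i assume "i \<in> f ` T"
    then obtain t where t: "t \<in> T" "i = \<lfloor>(t - a) / e\<rfloor>" by (auto simp: f_def)
    then have "a \<le> t" "t \<le> b" using T by auto
    then show "i \<in> {0..\<lfloor>(b - a) / e\<rfloor>}"
      using e unfolding t(2) by (auto intro!: floor_mono divide_right_mono)
  qed
  then show "finite T"
    using inj by (metis finite_atLeastAtMost_int finite_imageD finite_subset)
  have "card T = card (f ` T)" using inj by (simp add: card_image)
  also have "\<dots> \<le> card {0..\<lfloor>(b - a) / e\<rfloor>}"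
    using sub by (intro card_mono) auto
  also have "\<dots> = nat (\<lfloor>(b - a) / e\<rfloor> + 1)" by simp
  finally have "int (card T) \<le> \<lfloor>(b - a) / e\<rfloor> + 1"
    using ab e by (simp add: le_nat_iff)
  then show "real (card T) \<le> 1 + (b - a) / e"
    by linarith
qed

text \<open>Fractions need not be reduced. The cutoff at \<open>Q / 8\<close> keeps every
  denominator comparable to \<open>Q\<close>, so that a Dirichlet error \<open>1 / (q * Q)\<close>
  is of order \<open>1 / Q^2\<close>, yet is low enough that discarding smaller denominators loses
  only part of the measure.\<close>

definition farey_points :: "nat \<Rightarrow> real set" where
  "farey_points Q = {of_int p / real q | p q. Q < 8 * q \<and> q \<le> Q}"

text \<open>Over the common denominator the numerator of the difference is a nonzero
  integer.\<close>

lemma fraction_diff_ge: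
  fixes p p' :: int and q q' :: nat
  assumes "q > 0" "q' > 0" "of_int p / real q \<noteq> of_int p' / real q'"
  shows "1 / (real q * real q') \<le> \<bar>of_int p / real q - of_int p' / real q'\<bar>"
proof -
  define D where "D = p * int q' - p' * int q"
  have eq: "of_int p / real q - of_int p' / real q' = of_int D / (real q * real q')"
    using assms by (simp add: D_def field_simps)
  then have "D \<noteq> 0" using assms by auto
  then have "1 \<le> \<bar>real_of_int D\<bar>" by linarith
  then show ?thesis unfolding eq by (simp add: abs_divide abs_mult divide_right_mono)
qed

lemma farey_points_separated:
  assumes "s \<in> farey_points Q" "t \<in> farey_points Q" "s \<noteq> t"
  shows "1 / (real Q)\<^sup>2 \<le> \<bar>s - t\<bar>"
proof -
  obtain p q where s: "s = of_int p / real q" "Q < 8 * q" "q \<le> Q"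
    using assms by (auto simp: farey_points_def)
  obtain p' q' where t: "t = of_int p' / real q'" "Q < 8 * q'" "q' \<le> Q"
    using assms by (auto simp: farey_points_def)
  have q: "q > 0" "q' > 0" using s t by auto
  have "real q * real q' \<le> real Q * real Q"
    using s t by (intro mult_mono) auto
  then have "1 / (real Q)\<^sup>2 \<le> 1 / (real q * real q')"
    using q s(3) by (auto simp: power2_eq_square intro!: divide_left_mono mult_pos_pos)
  also have "\<dots> \<le> \<bar>s - t\<bar>"
    unfolding s t using fraction_diff_ge[OF q] assms(3) s(1) t(1) by simp
  finally show ?thesis .
qed

lemma
  assumes "a \<le> b" "Q > 0"
  shows finite_farey_points: "finite (farey_points Q \<inter> {a..b})"
    and card_farey_points_le: "real (card (farey_points Q \<inter> {a..b})) \<le> 1 + (b - a) * (real Q)\<^sup>2"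
proof -
  have *: "farey_points Q \<inter> {a..b} \<subseteq> {a..b}" "1 / (real Q)\<^sup>2 > 0"
    using assms by auto
  have "e \<le> \<bar>s - t\<bar>" if "e = 1 / (real Q)\<^sup>2" "s \<in> farey_points Q \<inter> {a..b}"
    "t \<in> farey_points Q \<inter> {a..b}" "s \<noteq> t" for e s t
    using that farey_points_separated by blast
  note card_separated_le[OF *(1) assms(1) *(2) this[OF refl]]
  then show "finite (farey_points Q \<inter> {a..b})"
    "real (card (farey_points Q \<inter> {a..b})) \<le> 1 + (b - a) * (real Q)\<^sup>2"
    by (auto simp: field_simps)
qed

text \<open>A crude bound in place of the logarithm: the sum is later divided by \<open>Q\<close>,
  so any sublinear growth will do. The induction compares \<open>1 / sqrt (N + 1)\<close> with the
  increment of \<open>2 * sqrt N\<close>.\<close>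

lemma sum_inverse_le_sqrt: "(\<Sum>q=1..N. 1 / real q) \<le> 2 * sqrt (real N)"
proof (induction N)
  case (Suc N)
  have "sqrt (real N) \<le> sqrt (real (Suc N))" by simp
  moreover have "(sqrt (real (Suc N)) - sqrt (real N)) * (sqrt (real (Suc N)) + sqrt (real N)) = 1"
    by (simp add: algebra_simps)
  moreover have "0 \<le> sqrt (real (Suc N)) - sqrt (real N)" by simp
  ultimately have "1 \<le> (sqrt (real (Suc N)) - sqrt (real N)) * (2 * sqrt (real (Suc N)))"
    by (metis add_mono mult_2 mult_left_mono order_refl)
  moreover have "1 \<le> sqrt (real (Suc N))" by simp
  ultimately have "1 / sqrt (real (Suc N)) \<le> 2 * sqrt (real (Suc N)) - 2 * sqrt (real N)"
    by (simp add: field_simps)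
  moreover have "sqrt (real (Suc N)) \<le> real (Suc N)"
    by (rule real_le_lsqrt) (auto simp: power2_eq_square algebra_simps)
  then have "1 / real (Suc N) \<le> 1 / sqrt (real (Suc N))"
    by (intro divide_left_mono) auto
  ultimately show ?case using Suc by simp
qed simp

text \<open>For a single denominator the spacing is \<open>1 / q\<close>, much wider than the
  \<open>1 / Q^2\<close> valid for all denominators together. This makes the contribution of small
  denominators controllable.\<close>

lemma
  fixes q :: nat
  assumes "a \<le> b" "q > 0"
  shows finite_fractions: "finite {p::int. of_int p / real q \<in> {a..b}}"
    and card_fractions_le: "real (card {p::int. of_int p / real q \<in> {a..b}}) \<le> 1 + (b - a) * real q"
proof -
  define P where "P = {p::int. of_int p / real q \<in> {a..b}}"
  define T where "T = (\<lambda>p::int. of_int p / real q) ` P"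
  have inj: "inj_on (\<lambda>p::int. of_int p / real q) P"
    using assms by (auto intro!: inj_onI)
  have sep: "1 / real q \<le> \<bar>s - t\<bar>" if "s \<in> T" "t \<in> T" "s \<noteq> t" for s t
  proof -
    obtain p p' where pp: "s = of_int p / real q" "t = of_int p' / real q"
      using \<open>s \<in> T\<close> \<open>t \<in> T\<close> by (auto simp: T_def)
    then have "p \<noteq> p'" using \<open>s \<noteq> t\<close> by auto
    then have "1 \<le> \<bar>real_of_int p - of_int p'\<bar>" by linarith
    then show ?thesis
      using assms by (simp add: pp flip: diff_divide_distrib) (simp add: divide_right_mono)
  qed
  have "T \<subseteq> {a..b}" by (auto simp: T_def P_def)
  note * = card_separated_le[OF this assms(1) _ sep]
  show "finite P" using *(1) assms inj by (simp add: T_def finite_image_iff)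
  show "real (card P) \<le> 1 + (b - a) * real q"
    using *(2) assms inj by (simp add: T_def card_image)
qed

text \<open>Dirichlet intervals cover the middle half of \<open>{a..b}\<close>, of length
  \<open>L / 2\<close>. Those with denominator at most \<open>Q / 8\<close> have total length at
  most \<open>3 * L / 8\<close>, so those about points of \<open>farey_points Q\<close>, each
  enlarged to length \<open>16 / Q^2\<close>, have total length at least
  \<open>L / 8\<close>.\<close>

lemma card_farey_points_ge:
  assumes ab: "a < b" and Q: "0 < Q" "(32 / (b - a))\<^sup>2 \<le> real Q"
  shows "(b - a) * (real Q)\<^sup>2 / 128 \<le> real (card (farey_points Q \<inter> {a..b}))"
proof -
  define L where "L = b - a"
  have L: "L > 0" using ab by (simp add: L_def)
  define r where "r = sqrt (real Q)"
  have r: "32 / L \<le> r" "1 \<le> r" "r\<^sup>2 = real Q"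
    using Q L by (auto simp: r_def L_def real_le_rsqrt)
  have "r * 1 \<le> r * r" using r by (intro mult_left_mono) auto
  then have "r \<le> real Q" using r(3) by (simp add: power2_eq_square)
  then have "32 / L \<le> real Q" using r by simp
  then have Qinv: "32 * (1 / real Q) \<le> L" and Q1: "1 / real Q \<le> 1" using L Q(1) by (simp_all add: field_simps)
  have Q2: "8 / (real Q)\<^sup>2 \<le> L / 4"
  proof -
    have "8 / (real Q)\<^sup>2 = 8 * (1 / real Q) * (1 / real Q)" by (simp add: power2_eq_square)
    also have "\<dots> \<le> 8 * (1 / real Q) * 1" using Q1 by (intro mult_left_mono) auto
    finally show ?thesis using Qinv by simp
  qed
  define T where "T = farey_points Q \<inter> {a..b}"
  define P where "P = (\<lambda>q::nat. {p::int. of_int p / real q \<in> {a..b}})"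
  \<comment> \<open>\<open>V\<close>: points whose Dirichlet approximation has a small denominator; these fill at most
    \<open>3/4\<close> of the middle half of the interval.\<close>
  define V where "V = (\<Union>q\<in>{1..Q div 8}. \<Union>p\<in>P q. {of_int p / real q - 1 / (real q * real Q) .. of_int p / real q + 1 / (real q * real Q)})"
  \<comment> \<open>The radius \<open>8 / Q^2\<close> dominates the Dirichlet error
    \<open>1 / (q * Q)\<close> as soon as \<open>Q < 8 * q\<close>.\<close>
  define W where "W = (\<Union>s\<in>T. {s - 8 / (real Q)\<^sup>2 .. s + 8 / (real Q)\<^sup>2})"
  have finT: "finite T" unfolding T_def using ab Q by (intro finite_farey_points) auto
  have finP: "finite (P q)" if "q \<in> {1..Q div 8}" for q
    unfolding P_def using ab that by (intro finite_fractions) auto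
  \<comment> \<open>Staying \<open>L / 4\<close> away from the endpoints forces the approximating
    fraction, at distance at most \<open>1 / Q\<close>, to lie in \<open>{a..b}\<close>.\<close>
  have cover: "{a + L/4 .. b - L/4} \<subseteq> V \<union> W"
  proof
    fix x assume x: "x \<in> {a + L/4 .. b - L/4}"
    obtain h k where hk: "0 < k" "k \<le> int Q" "\<bar>of_int k * x - of_int h\<bar> < 1 / Q"
      using Dirichlet_approx[OF Q(1)] by blast
    define q where "q = nat k"
    have q: "0 < q" "q \<le> Q" "real_of_int k = real q" using hk by (auto simp: q_def)
    have "\<bar>x - of_int h / real q\<bar> = \<bar>of_int k * x - of_int h\<bar> / real q"
      using q by (simp add: field_simps abs_divide flip: abs_mult)
    also have "\<dots> \<le> (1 / real Q) / real q"
      using hk q by (intro divide_right_mono) auto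
    finally have close: "\<bar>x - of_int h / real q\<bar> \<le> 1 / (real q * real Q)"
      by (simp add: mult.commute)
    have "1 / (real q * real Q) \<le> 1 / real Q"
      using q by (auto intro!: divide_left_mono simp: Q)
    then have "\<bar>x - of_int h / real q\<bar> \<le> L / 4" using close Qinv L by linarith
    then have inab: "of_int h / real q \<in> {a..b}" using x unfolding atLeastAtMost_iff by linarith
    show "x \<in> V \<union> W"
    proof (cases "8 * q \<le> Q")
      case True
      then have "q \<in> {1..Q div 8}" using q by auto
      moreover have "h \<in> P q" using inab by (simp add: P_def)
      moreover have "x \<in> {of_int h / real q - 1 / (real q * real Q) .. of_int h / real q + 1 / (real q * real Q)}"
        using close by (auto simp: abs_le_iff)
      ultimately show ?thesis unfolding V_def by blast
    next
      case False
      then have "Q < 8 * q" by simp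
      then have "of_int h / real q \<in> T"
        using inab q(2) unfolding T_def farey_points_def by blast
      moreover have "1 / (real q * real Q) \<le> 8 / (real Q)\<^sup>2"
        using False q Q(1) by (simp add: field_simps power2_eq_square)
      then have "x \<in> {of_int h / real q - 8 / (real Q)\<^sup>2 .. of_int h / real q + 8 / (real Q)\<^sup>2}"
        using close by (auto simp: abs_le_iff)
      ultimately show ?thesis unfolding W_def by blast
    qed
  qed
  have Vm: "V \<in> lmeasurable" unfolding V_def
    using finP by (intro fmeasurable.finite_UN) auto
  have Wm: "W \<in> lmeasurable" unfolding W_def
    using finT by (intro fmeasurable.finite_UN) auto
  have "measure lebesgue V \<le> (\<Sum>q\<in>{1..Q div 8}. measure lebesgue (\<Union>p\<in>P q. {of_int p / real q - 1 / (real q * real Q) .. of_int p / real q + 1 / (real q * real Q)}))"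
    unfolding V_def using finP by (intro measure_UNION_le sets.finite_UN) auto
  \<comment> \<open>There are at most \<open>1 + L * q\<close> fractions of denominator
    \<open>q\<close>. The terms \<open>L * q\<close> contribute \<open>L / 4\<close> in all; the
    terms \<open>1\<close> contribute a harmonic sum over \<open>Q\<close>, at most
    \<open>4 / r\<close> and hence at most \<open>L / 8\<close>.\<close>
  also have "\<dots> \<le> (\<Sum>q\<in>{1..Q div 8}. 2 * L / real Q + 2 / real Q * (1 / real q))"
  proof (rule sum_mono)
    fix q assume q: "q \<in> {1..Q div 8}"
    have "measure lebesgue (\<Union>p\<in>P q. {of_int p / real q - 1 / (real q * real Q) .. of_int p / real q + 1 / (real q * real Q)})
       \<le> (\<Sum>p\<in>P q. measure lebesgue {of_int p / real q - 1 / (real q * real Q) .. of_int p / real q + 1 / (real q * real Q)})"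
      using finP[OF q] by (intro measure_UNION_le) auto
    also have "\<dots> = real (card (P q)) * (2 / (real q * real Q))" by simp
    also have "\<dots> \<le> (1 + L * real q) * (2 / (real q * real Q))"
      using card_fractions_le[of a b q] ab q by (intro mult_right_mono) (auto simp: P_def L_def)
    also have "\<dots> = 2 * L / real Q + 2 / real Q * (1 / real q)"
      using q Q(1) by (simp add: field_simps)
    finally show "measure lebesgue (\<Union>p\<in>P q. {of_int p / real q - 1 / (real q * real Q) .. of_int p / real q + 1 / (real q * real Q)})
       \<le> 2 * L / real Q + 2 / real Q * (1 / real q)" .
  qed
  also have "\<dots> = real (Q div 8) * (2 * L / real Q) + 2 / real Q * (\<Sum>q=1..Q div 8. 1 / real q)"
    by (simp add: sum.distrib sum_distrib_left)
  also have "\<dots> \<le> (real Q / 8) * (2 * L / real Q) + 2 / real Q * (2 * r)"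
  proof (intro add_mono mult_mono mult_left_mono)
    have "real (8 * (Q div 8)) \<le> real Q" unfolding of_nat_le_iff by simp
    then show "real (Q div 8) \<le> real Q / 8" by simp
    have "(\<Sum>q=1..Q div 8. 1 / real q) \<le> 2 * sqrt (real (Q div 8))" by (rule sum_inverse_le_sqrt)
    also have "\<dots> \<le> 2 * r" by (simp add: r_def)
    finally show "(\<Sum>q=1..Q div 8. 1 / real q) \<le> 2 * r" .
  qed (use L in \<open>auto intro: sum_nonneg\<close>)
  also have "\<dots> = L / 4 + 4 / r"
    using Q(1) r by (simp flip: r(3)) (simp add: field_simps power2_eq_square)
  also have "\<dots> \<le> L / 4 + L / 8"
    using r(1,2) L by (simp add: field_simps)
  finally have V: "measure lebesgue V \<le> L / 4 + L / 8" .
  have "measure lebesgue W \<le> (\<Sum>s\<in>T. measure lebesgue {s - 8 / (real Q)\<^sup>2 .. s + 8 / (real Q)\<^sup>2})"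
    unfolding W_def using finT by (intro measure_UNION_le) auto
  also have "\<dots> = real (card T) * (16 / (real Q)\<^sup>2)" by simp
  finally have W: "measure lebesgue W \<le> real (card T) * (16 / (real Q)\<^sup>2)" .
  have "L / 2 = measure lebesgue {a + L/4 .. b - L/4}" using L by (simp add: L_def field_simps)
  also have "\<dots> \<le> measure lebesgue (V \<union> W)"
    using cover Vm Wm by (intro measure_mono_fmeasurable) auto
  also have "\<dots> \<le> measure lebesgue V + measure lebesgue W"
    using Vm Wm by (intro measure_Un_le) auto
  finally have "L / 8 \<le> real (card T) * (16 / (real Q)\<^sup>2)" using V W by linarith
  then show ?thesis using Q(1) by (simp add: T_def L_def field_simps)
qed

section \<open>Measure-theoretic tools\<close>

text \<open>With the best \<open>t\<close>, the quotient of the two sums, this is the Chung-Erdos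
  inequality. Leaving \<open>t\<close> free avoids the division and lets estimates of the sums be
  inserted directly.\<close>

lemma measure_UN_ge_second_moment:
  fixes t :: real
  assumes fin: "finite J" and A: "\<And>i. i \<in> J \<Longrightarrow> A i \<in> fmeasurable M"
  shows "2 * t * (\<Sum>i\<in>J. measure M (A i)) - t\<^sup>2 * (\<Sum>i\<in>J. \<Sum>j\<in>J. measure M (A i \<inter> A j))
    \<le> measure M (\<Union>i\<in>J. A i)"
proof -
  \<comment> \<open>Integrate \<open>2 t N - t\<^sup>2 N\<^sup>2 = 1 - (1 - t N)\<^sup>2\<close>, where \<open>N\<close> counts the sets containing a point.\<close>
  define U where "U = (\<Union>i\<in>J. A i)"
  have U: "U \<in> fmeasurable M" unfolding U_def using fin A by (intro fmeasurable.finite_UN) auto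
  have int: "integrable M (indicator X :: _ \<Rightarrow> real)" "(\<integral>x. indicator X x \<partial>M) = measure M X"
    if "X \<in> fmeasurable M" for X
  proof -
    have X: "X \<inter> space M = X" "emeasure M X < \<infinity>" "X \<in> sets M"
      using that sets.sets_into_space by (auto simp: fmeasurable_def)
    show "integrable M (indicator X :: _ \<Rightarrow> real)" "(\<integral>x. indicator X x \<partial>M) = measure M X"
      using X by auto
  qed
  have AA: "A i \<inter> A j \<in> fmeasurable M" if "i \<in> J" "j \<in> J" for i j
    using A that by auto
  have sp: "A i \<inter> space M = A i" "A i \<inter> A j \<inter> space M = A i \<inter> A j" if "i \<in> J" for i j
    using sets.sets_into_space[OF fmeasurableD[OF A[OF that]]] by auto
  have point: "2 * t * (\<Sum>i\<in>J. indicator (A i) x) - t\<^sup>2 * (\<Sum>i\<in>J. \<Sum>j\<in>J. indicator (A i \<inter> A j) x)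
      \<le> (indicator U x :: real)" for x
  proof -
    define N :: real where "N = (\<Sum>i\<in>J. indicator (A i) x)"
    have "(\<Sum>i\<in>J. \<Sum>j\<in>J. indicator (A i \<inter> A j) x) = N * N"
      by (simp add: N_def sum_product indicator_inter_arith)
    moreover have "2 * t * N - t\<^sup>2 * (N * N) \<le> indicator U x"
    proof (cases "x \<in> U")
      case True
      have "2 * t * N - t\<^sup>2 * (N * N) = 1 - (1 - t * N)\<^sup>2"
        by (simp add: power2_eq_square algebra_simps)
      also have "\<dots> \<le> 1" by simp
      finally show ?thesis using True by simp
    next
      case False
      then have "N = 0" unfolding N_def U_def by (intro sum.neutral) auto
      then show ?thesis by simp
    qed
    ultimately show ?thesis by (simp add: N_def)
  qed
  have "2 * t * (\<Sum>i\<in>J. measure M (A i)) - t\<^sup>2 * (\<Sum>i\<in>J. \<Sum>j\<in>J. measure M (A i \<inter> A j))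
     = (\<integral>x. 2 * t * (\<Sum>i\<in>J. indicator (A i) x) - t\<^sup>2 * (\<Sum>i\<in>J. \<Sum>j\<in>J. indicator (A i \<inter> A j) x) \<partial>M)"
    using int(1)[OF A] int(1)[OF AA] sp by simp
  also have "\<dots> \<le> (\<integral>x. indicator U x \<partial>M)"
    using int(1)[OF A] int(1)[OF AA] int(1)[OF U] point
    by (intro integral_mono) auto
  also have "\<dots> = measure M U" by (rule int(2)[OF U])
  finally show ?thesis by (simp add: U_def)
qed

text \<open>A form of the Lebesgue density theorem. An open set only slightly larger than
  \<open>F\<close> contains non-overlapping intervals covering \<open>F\<close>; summing the density
  bound over them shows that \<open>F\<close> has at most about \<open>\<theta>\<close> times its
  own measure.\<close>

lemma negligible_density_bounded:
  fixes F :: "real set"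
  assumes F: "F \<in> sets lebesgue" "F \<subseteq> {u..v}" and uv: "u < v" and \<theta>: "0 \<le> \<theta>" "\<theta> < 1"
    and dens: "\<And>a b. a < b \<Longrightarrow> measure lebesgue (F \<inter> {a..b}) \<le> \<theta> * (b - a)"
  shows "negligible F"
proof -
  have Fm: "F \<in> lmeasurable"
    using F by (metis bounded_closed_interval bounded_set_imp_lmeasurable bounded_subset)
  define m where "m = measure lebesgue F"
  have "m \<le> 0"
  proof (rule ccontr)
    assume "\<not> m \<le> 0"
    then have m: "m > 0" by simp
    \<comment> \<open>With this \<open>e\<close> the final deficit
      \<open>m - \<theta> * (m + e)\<close> equals \<open>m * (1 - \<theta>)^2\<close>, which is
      positive.\<close>
    define e where "e = m * (1 - \<theta>)"
    have e: "e > 0" using m \<theta> by (simp add: e_def)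
    obtain T where T: "open T" "F \<subseteq> T" "T - F \<in> lmeasurable" "emeasure lebesgue (T - F) < ennreal e"
      using sets_lebesgue_outer_open[OF F(1) e] .
    have "T = F \<union> (T - F)" using T by auto
    then have Tm: "T \<in> lmeasurable" using T(3) Fm by (metis fmeasurable.Un)
    have "measure lebesgue (T - F) < e"
      using T(3,4) e by (simp add: emeasure_eq_measure2 ennreal_less_iff)
    moreover have "measure lebesgue T \<le> measure lebesgue F + measure lebesgue (T - F)"
      using \<open>T = F \<union> (T - F)\<close> measure_Un_le[of F lebesgue "T - F"] Fm T(3) by auto
    ultimately have mT: "measure lebesgue T \<le> m + e" by (simp add: m_def)
    \<comment> \<open>Every covering interval has its tag in \<open>F\<close>, hence in
      \<open>T\<close>, and so lies inside \<open>T\<close>; the value \<open>UNIV\<close> elsewhere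
      only completes \<open>g\<close> to a gauge.\<close>
    define g where "g = (\<lambda>x. if x \<in> T then T else UNIV)"
    have "gauge g" using T(1) by (auto simp: gauge_def g_def)
    moreover have "box u v \<noteq> {}" "F \<subseteq> cbox u v" using uv F by auto
    ultimately obtain D where D: "countable D" "\<Union>D \<subseteq> cbox u v"
      "\<And>K. K \<in> D \<Longrightarrow> interior K \<noteq> {} \<and> (\<exists>c d. K = cbox c d)"
      "pairwise (\<lambda>A B. interior A \<inter> interior B = {}) D"
      "\<And>K. K \<in> D \<Longrightarrow> \<exists>x \<in> F \<inter> K. K \<subseteq> g x" "F \<subseteq> \<Union>D"
      using covering_lemma[of F u v g] by metis
    have DT: "K \<subseteq> T" if "K \<in> D" for K
      using D(5)[OF that] T(2) by (auto simp: g_def split: if_splits)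
    have Dm: "K \<in> lmeasurable" if "K \<in> D" for K
      using D(3)[OF that] by auto
    have neg: "pairwise (\<lambda>S T. negligible (S \<inter> T)) D"
    proof (rule pairwiseI)
      fix S T' assume ST: "S \<in> D" "T' \<in> D" "S \<noteq> T'"
      then have "convex (S \<inter> T')" using D(3)[of S] D(3)[of T'] by (auto intro!: convex_Int)
      moreover have "interior (S \<inter> T') = {}" using D(4) ST by (simp add: pairwise_def)
      ultimately show "negligible (S \<inter> T')" by (simp add: negligible_convex_interior)
    qed
    have dK: "measure lebesgue (F \<inter> K) \<le> \<theta> * measure lebesgue K" if K: "K \<in> D" for K
    proof -
      obtain a b where ab: "K = {a..b}" "interior K \<noteq> {}" using D(3)[OF K] by auto
      then have "a < b" by (auto simp: interior_atLeastAtMost_real)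
      then show ?thesis using dens[of a b] by (simp add: ab)
    qed
    \<comment> \<open>A bound uniform over finite subfamilies carries over to the countable
      union.\<close>
    have "measure lebesgue (\<Union>K\<in>D. F \<inter> K) \<le> \<theta> * (m + e)"
    proof (rule measure_UN_bound[OF D(1)])
      show "F \<inter> K \<in> lmeasurable" if "K \<in> D" for K using Fm Dm[OF that] by auto
    next
      fix D' assume D': "D' \<subseteq> D" "finite D'"
      have "measure lebesgue (\<Union>K\<in>D'. F \<inter> K) \<le> (\<Sum>K\<in>D'. measure lebesgue (F \<inter> K))"
        using D' Dm F(1) by (intro measure_UNION_le) (auto dest!: fmeasurableD)
      also have "\<dots> \<le> (\<Sum>K\<in>D'. \<theta> * measure lebesgue K)"
        using dK D' by (intro sum_mono) auto
      also have "\<dots> = \<theta> * measure lebesgue (\<Union>D')"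
        using D' Dm neg
        by (subst measure_negligible_finite_Union) (auto simp: sum_distrib_left pairwise_mono intro: pairwise_mono)
      also have "\<dots> \<le> \<theta> * measure lebesgue T"
      proof (intro mult_left_mono measure_mono_fmeasurable)
        show "\<Union>D' \<subseteq> T" using D' DT by auto
        show "\<Union>D' \<in> sets lebesgue" using D' Dm by (intro sets.finite_Union) (auto dest!: fmeasurableD)
      qed (use Tm \<theta> in auto)
      also have "\<dots> \<le> \<theta> * (m + e)" using mT \<theta> by (intro mult_left_mono) auto
      finally show "measure lebesgue (\<Union>K\<in>D'. F \<inter> K) \<le> \<theta> * (m + e)" .
    qed
    moreover have "(\<Union>K\<in>D. F \<inter> K) = F" using D(6) by auto
    ultimately have "m \<le> \<theta> * (m + e)" by (simp add: m_def)
    moreover have "m - \<theta> * (m + e) = m * (1 - \<theta>)\<^sup>2"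
      by (simp add: e_def power2_eq_square algebra_simps)
    moreover have "m * (1 - \<theta>)\<^sup>2 > 0" using m \<theta> by simp
    ultimately show False by linarith
  qed
  then have "measure lebesgue F = 0" by (simp add: m_def measure_le_0_iff)
  then show ?thesis using Fm by (simp add: negligible_iff_measure)
qed

section \<open>Approximation of almost every number\<close>

text \<open>
  The scales \<open>k!\<close> are sparse enough that an interval of length \<open>2 * farey_radius k\<close> contains
  about as many points of scale \<open>l > k\<close> as its length predicts, and dense enough that
  \<open>ln (k!) \<le> k * ln k\<close>.
\<close>
definition farey_radius :: "nat \<Rightarrow> real" where
  "farey_radius k = 1 / (2 * real k * (fact k)\<^sup>2)"

definition farey_nbhd :: "nat \<Rightarrow> real set" where
  "farey_nbhd k = (\<Union>s\<in>farey_points (fact k). ball s (farey_radius k))"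

lemma farey_radius_pos: "0 < k \<Longrightarrow> 0 < farey_radius k"
  by (simp add: farey_radius_def)

lemma farey_nbhd_lebesgue [measurable]: "farey_nbhd k \<in> sets lebesgue"
proof -
  have "open (farey_nbhd k)" by (auto simp: farey_nbhd_def)
  then show ?thesis by simp
qed

text \<open>Replaces the infinite family of centres by the finitely many that can reach
  \<open>{a..b}\<close>.\<close>

lemma farey_nbhd_Int_subset:
  "farey_nbhd k \<inter> {a..b} \<subseteq>
    (\<Union>s\<in>farey_points (fact k) \<inter> {a - farey_radius k..b + farey_radius k}. ball s (farey_radius k))"
proof
  fix x assume x: "x \<in> farey_nbhd k \<inter> {a..b}"
  then obtain s where s: "s \<in> farey_points (fact k)" "dist s x < farey_radius k"
    by (auto simp: farey_nbhd_def)
  then have "s \<in> {a - farey_radius k..b + farey_radius k}"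
    using x by (auto simp: dist_real_def)
  then show "x \<in> (\<Union>s\<in>farey_points (fact k) \<inter> {a - farey_radius k..b + farey_radius k}. ball s (farey_radius k))"
    using s by auto
qed

text \<open>The count is the main term plus \<open>1\<close> plus at most \<open>1\<close> for the
  enlargement; the lower bound on the length lets the main term absorb both.\<close>

lemma card_farey_points_enlarged_le:
  assumes k: "0 < k" and ab: "a < b" and L: "1 \<le> (b - a) * (fact k)\<^sup>2"
  shows "finite (farey_points (fact k) \<inter> {a - farey_radius k..b + farey_radius k})"
    "real (card (farey_points (fact k) \<inter> {a - farey_radius k..b + farey_radius k}))
      \<le> 3 * (b - a) * (fact k)\<^sup>2"
proof -
  have r: "0 < farey_radius k" using k by (rule farey_radius_pos)
  then have le: "a - farey_radius k \<le> b + farey_radius k" using ab by linarith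
  show "finite (farey_points (fact k) \<inter> {a - farey_radius k..b + farey_radius k})"
    using le by (intro finite_farey_points) auto
  have "real (card (farey_points (fact k) \<inter> {a - farey_radius k..b + farey_radius k}))
      \<le> 1 + (b + farey_radius k - (a - farey_radius k)) * (real (fact k))\<^sup>2"
    using le by (intro card_farey_points_le) auto
  also have "\<dots> = 1 + (b - a) * (fact k)\<^sup>2 + 2 * farey_radius k * (fact k)\<^sup>2"
    by (simp add: algebra_simps)
  also have "2 * farey_radius k * (fact k)\<^sup>2 = 1 / real k"
    using k by (simp add: farey_radius_def field_simps)
  also have "1 / real k \<le> 1" using k by simp
  finally show "real (card (farey_points (fact k) \<inter> {a - farey_radius k..b + farey_radius k}))
      \<le> 3 * (b - a) * (fact k)\<^sup>2" using L by linarith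
qed

lemma measure_ball_real: "0 \<le> r \<Longrightarrow> measure lebesgue (ball s r) = 2 * r" for s r :: real
  by (simp add: ball_eq_greaterThanLessThan)

lemma measure_farey_nbhd_le:
  assumes k: "0 < k" and ab: "a < b" and L: "1 \<le> (b - a) * (fact k)\<^sup>2"
  shows "measure lebesgue (farey_nbhd k \<inter> {a..b}) \<le> 3 * (b - a) / real k"
proof -
  define T where "T = farey_points (fact k) \<inter> {a - farey_radius k..b + farey_radius k}"
  note T = card_farey_points_enlarged_le[OF assms, folded T_def]
  have r: "0 < farey_radius k" using k by (rule farey_radius_pos)
  have "measure lebesgue (farey_nbhd k \<inter> {a..b}) \<le> measure lebesgue (\<Union>s\<in>T. ball s (farey_radius k))"
    using farey_nbhd_Int_subset[of k a b] T(1) unfolding T_def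
    by (intro measure_mono_fmeasurable fmeasurable.finite_UN) auto
  also have "\<dots> \<le> (\<Sum>s\<in>T. measure lebesgue (ball s (farey_radius k)))"
    using T(1) by (intro measure_UNION_le) auto
  also have "\<dots> = real (card T) * (2 * farey_radius k)"
    using measure_ball_real[OF less_imp_le[OF r]] by (simp only: sum_constant)
  also have "\<dots> \<le> (3 * (b - a) * (fact k)\<^sup>2) * (2 * farey_radius k)"
    using T(2) r by (intro mult_right_mono) auto
  also have "\<dots> = 3 * (b - a) / real k"
    using k by (simp add: farey_radius_def field_simps)
  finally show ?thesis .
qed

text \<open>Quasi-independence: the set of scale \<open>k\<close> consists of few intervals, and in
  each of them the finer set of scale \<open>l\<close> has relative measure at most
  \<open>3 / l\<close>. The upper bound is thus used twice, whence \<open>9 = 3 * 3\<close>.\<close>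

lemma measure_farey_nbhd_Int_le:
  assumes k: "0 < k" and kl: "k < l" and ab: "a < b" and L: "1 \<le> (b - a) * (fact k)\<^sup>2"
  shows "measure lebesgue (farey_nbhd k \<inter> farey_nbhd l \<inter> {a..b}) \<le> 9 * (b - a) / (real k * real l)"
proof -
  define T where "T = farey_points (fact k) \<inter> {a - farey_radius k..b + farey_radius k}"
  note T = card_farey_points_enlarged_le[OF k ab L, folded T_def]
  have r: "0 < farey_radius k" using k by (rule farey_radius_pos)
  have l: "0 < l" using kl by simp
  \<comment> \<open>Passing from \<open>k!\<close> to \<open>(k + 1)!\<close> already outweighs the
    factor \<open>k\<close> in the radius, so an interval of length
    \<open>2 * farey_radius k\<close> is long enough for the count at scale
    \<open>l\<close>.\<close>
  have "real k \<le> (real (Suc k))\<^sup>2" by (simp add: power2_eq_square algebra_simps)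
  then have "real k * (fact k)\<^sup>2 \<le> (real (Suc k))\<^sup>2 * (fact k)\<^sup>2" by (intro mult_right_mono) auto
  also have "\<dots> = (fact (Suc k))\<^sup>2" by (simp add: power_mult_distrib)
  also have "\<dots> \<le> (fact l)\<^sup>2" using kl by (intro power_mono fact_mono) auto
  finally have "1 \<le> 2 * farey_radius k * (fact l)\<^sup>2"
    using k by (simp add: farey_radius_def field_simps)
  then have one: "measure lebesgue (farey_nbhd l \<inter> {s - farey_radius k..s + farey_radius k})
      \<le> 6 * farey_radius k / real l" for s
    using measure_farey_nbhd_le[OF l, of "s - farey_radius k" "s + farey_radius k"] r by simp
  have "measure lebesgue (farey_nbhd k \<inter> farey_nbhd l \<inter> {a..b})
      \<le> measure lebesgue (\<Union>s\<in>T. farey_nbhd l \<inter> {s - farey_radius k..s + farey_radius k})"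
  proof (intro measure_mono_fmeasurable fmeasurable.finite_UN)
    show "farey_nbhd k \<inter> farey_nbhd l \<inter> {a..b}
        \<subseteq> (\<Union>s\<in>T. farey_nbhd l \<inter> {s - farey_radius k..s + farey_radius k})"
    proof
      fix x assume x: "x \<in> farey_nbhd k \<inter> farey_nbhd l \<inter> {a..b}"
      then obtain s where "s \<in> T" "x \<in> ball s (farey_radius k)"
        using farey_nbhd_Int_subset[of k a b] unfolding T_def by blast
      then show "x \<in> (\<Union>s\<in>T. farey_nbhd l \<inter> {s - farey_radius k..s + farey_radius k})"
        using x by (auto simp: dist_real_def intro!: bexI[of _ s])
    qed
    show "farey_nbhd l \<inter> {s - farey_radius k..s + farey_radius k} \<in> lmeasurable" for s
      by (intro bounded_set_imp_lmeasurable) (auto intro: bounded_subset[OF bounded_closed_interval])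
  qed (use T in auto)
  also have "\<dots> \<le> (\<Sum>s\<in>T. measure lebesgue (farey_nbhd l \<inter> {s - farey_radius k..s + farey_radius k}))"
    using T(1) by (intro measure_UNION_le) auto
  also have "\<dots> \<le> (\<Sum>s\<in>T. 6 * farey_radius k / real l)" by (intro sum_mono one)
  also have "\<dots> = real (card T) * (6 * farey_radius k / real l)" by simp
  also have "\<dots> \<le> (3 * (b - a) * (fact k)\<^sup>2) * (6 * farey_radius k / real l)"
    using T(2) r by (intro mult_right_mono) auto
  also have "\<dots> = 9 * (b - a) / (real k * real l)"
    using k l by (simp add: farey_radius_def field_simps)
  finally show ?thesis .
qed

text \<open>Centres in the middle half have disjoint balls inside \<open>{a..b}\<close>, so their
  measures add up: at least \<open>(L / 2) * (k!)^2 / 128\<close> balls of length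
  \<open>1 / (k * (k!)^2)\<close>.\<close>

lemma measure_farey_nbhd_ge:
  assumes k: "0 < k" and ab: "a < b" and Q: "(64 / (b - a))\<^sup>2 \<le> fact k" and r4: "farey_radius k \<le> (b - a) / 4"
  shows "(b - a) / (256 * real k) \<le> measure lebesgue (farey_nbhd k \<inter> {a..b})"
proof -
  define L where "L = b - a"
  define T where "T = farey_points (fact k) \<inter> {a + L / 4..b - L / 4}"
  have L: "L > 0" using ab by (simp add: L_def)
  have r: "0 < farey_radius k" using k by (rule farey_radius_pos)
  have len: "a + L / 4 < b - L / 4" "b - L / 4 - (a + L / 4) = L / 2"
    using L by (simp_all add: L_def field_simps)
  have finT: "finite T" unfolding T_def using len by (intro finite_farey_points) auto
  have "32 / (L / 2) = 64 / (b - a)" by (simp add: L_def)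
  then have card: "L / 2 * (fact k)\<^sup>2 / 128 \<le> real (card T)"
    using card_farey_points_ge[OF len(1), of "fact k", unfolded len(2)] Q
    by (simp only: T_def of_nat_fact fact_gt_zero)
  \<comment> \<open>The diameter of a ball does not exceed the least distance between
    centres.\<close>
  have "2 * farey_radius k \<le> 1 / (real (fact k))\<^sup>2"
    using k by (simp add: farey_radius_def field_simps)
  then have disj: "ball s (farey_radius k) \<inter> ball t (farey_radius k) = {}"
    if "s \<in> T" "t \<in> T" "s \<noteq> t" for s t
    using farey_points_separated[of s "fact k" t] that
    by (intro disjoint_ballI) (auto simp: T_def dist_real_def)
  have "L / (256 * real k) = L / 2 * (fact k)\<^sup>2 / 128 * (2 * farey_radius k)"
    using k by (simp add: farey_radius_def field_simps)
  also have "\<dots> \<le> real (card T) * (2 * farey_radius k)"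
    using card r by (intro mult_right_mono) auto
  also have "\<dots> = (\<Sum>s\<in>T. measure lebesgue (ball s (farey_radius k)))"
    using measure_ball_real[OF less_imp_le[OF r]] by (simp only: sum_constant)
  also have "\<dots> = measure lebesgue (\<Union>s\<in>T. ball s (farey_radius k))"
    using finT disj by (intro measure_negligible_finite_Union_image[symmetric]) (auto simp: pairwise_def)
  also have "\<dots> \<le> measure lebesgue (farey_nbhd k \<inter> {a..b})"
  proof (intro measure_mono_fmeasurable)
    show "(\<Union>s\<in>T. ball s (farey_radius k)) \<subseteq> farey_nbhd k \<inter> {a..b}"
    proof
      fix x assume "x \<in> (\<Union>s\<in>T. ball s (farey_radius k))"
      then obtain s where s: "s \<in> T" "\<bar>s - x\<bar> < farey_radius k" by (auto simp: dist_real_def)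
      then have "x \<in> farey_nbhd k" by (auto simp: farey_nbhd_def T_def dist_real_def)
      moreover have "x \<in> {a..b}"
        using s r4 unfolding T_def L_def Int_iff atLeastAtMost_iff by linarith
      ultimately show "x \<in> farey_nbhd k \<inter> {a..b}" by simp
    qed
    show "farey_nbhd k \<inter> {a..b} \<in> lmeasurable"
      by (intro bounded_set_imp_lmeasurable) (auto intro: bounded_subset[OF bounded_closed_interval])
    show "(\<Union>s\<in>T. ball s (farey_radius k)) \<in> sets lebesgue"
      using finT by (intro sets.finite_UN) auto
  qed
  finally show ?thesis by (simp add: L_def)
qed

text \<open>The proportion depends neither on \<open>K\<close> nor on the interval. With
  \<open>h\<close> the harmonic sum over a block of scales, the first moment is at least
  \<open>L * h / 256\<close> and the second at most \<open>12 * L * h^2\<close>, so \<open>h\<close>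
  cancels in the second moment bound.\<close>

lemma measure_UN_farey_nbhd_ge:
  assumes ab: "a < b"
  shows "(b - a) / 786432 \<le> measure lebesgue ((\<Union>k\<in>{K..}. farey_nbhd k) \<inter> {a..b})"
proof -
  define L where "L = b - a"
  have L: "L > 0" using ab by (simp add: L_def)
  \<comment> \<open>One threshold beyond which all the largeness conditions of the single-scale and
    two-scale estimates hold; each summand serves one of them.\<close>
  obtain K1 :: nat where K1: "1 + K + (64 / L)\<^sup>2 + 1 / L + 4 / L \<le> real K1"
    using real_arch_simple by blast
  have pos: "(64 / L)\<^sup>2 \<ge> 0" "1 / L > 0" "4 / L > 0" using L by auto
  have big: "0 < k" "K \<le> k" "(64 / L)\<^sup>2 \<le> fact k" "farey_radius k \<le> L / 4" "1 \<le> L * (fact k)\<^sup>2"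
    if "K1 \<le> k" for k
  proof -
    have rk: "real K1 \<le> real k" using that by simp
    show k: "0 < k" using K1 pos rk by (intro gr0I) auto
    show "K \<le> k" using K1 pos rk by linarith
    have fk: "real k \<le> fact k" by (metis fact_ge_self of_nat_fact of_nat_le_iff)
    show "(64 / L)\<^sup>2 \<le> fact k" using fk K1 pos rk by linarith
    have f1: "(1::real) \<le> fact k" by simp
    have f2: "(fact k :: real) \<le> (fact k)\<^sup>2" by (simp add: power2_eq_square)
    have "1 / L \<le> (fact k)\<^sup>2" using fk K1 pos rk f2 by linarith
    then show "1 \<le> L * (fact k)\<^sup>2" using L by (simp add: field_simps)
    have "4 / L \<le> (fact k)\<^sup>2" using fk K1 pos rk f2 by linarith
    also have "\<dots> \<le> 2 * real k * (fact k)\<^sup>2" using k by simp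
    finally show "farey_radius k \<le> L / 4"
      using L k by (simp add: farey_radius_def field_simps)
  qed
  define H where "H = (\<lambda>M. \<Sum>k\<in>{K1..<M}. 1 / real k)"
  \<comment> \<open>Harmonic divergence enters here. Having \<open>h \<ge> 1\<close> later lets
    \<open>h^2\<close> absorb the diagonal term, which is linear in \<open>h\<close>.\<close>
  obtain M where M: "1 \<le> H M"
  proof -
    have "\<not> summable (\<lambda>n. 1 / real n)"
      using not_summable_harmonic[where 'a=real] by (simp add: inverse_eq_divide)
    moreover have "summable (\<lambda>n. 1 / real (n + K1))" if "\<And>M. H M < 1"
    proof (rule summableI_nonneg_bounded[where x=1])
      fix n
      have "(\<Sum>i<n. 1 / real (i + K1)) = H (n + K1)"
        unfolding H_def using sum.shift_bounds_nat_ivl[of "\<lambda>k. 1 / real k" 0 K1 n]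
        by (simp add: lessThan_atLeast0)
      then show "(\<Sum>i<n. 1 / real (i + K1)) \<le> 1" using that[of "n + K1"] by simp
    qed simp
    ultimately show ?thesis using that summable_iff_shift[of "\<lambda>n. 1 / real n" K1]
      by (meson not_less)
  qed
  define J where "J = {K1..<M}"
  define A where "A = (\<lambda>k. farey_nbhd k \<inter> {a..b})"
  define h where "h = H M"
  have h: "1 \<le> h" "h = (\<Sum>k\<in>J. 1 / real k)" using M by (simp_all add: h_def H_def J_def)
  have Am: "A k \<in> lmeasurable" for k
    unfolding A_def
    by (intro bounded_set_imp_lmeasurable) (auto intro: bounded_subset[OF bounded_closed_interval])
  have lower: "L / 256 * h \<le> (\<Sum>k\<in>J. measure lebesgue (A k))"
    unfolding h(2) sum_distrib_left
  proof (rule sum_mono)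
    fix k assume "k \<in> J"
    then have "K1 \<le> k" by (simp add: J_def)
    from measure_farey_nbhd_ge[OF big(1)[OF this] ab] big[OF this]
    show "L / 256 * (1 / real k) \<le> measure lebesgue (A k)" by (simp add: A_def L_def)
  qed
  \<comment> \<open>Distinct scales give the product of \<open>1 / i\<close> and
    \<open>1 / j\<close>; a diagonal pair has just one such factor and is paid for by the extra
    term.\<close>
  have pair: "measure lebesgue (A i \<inter> A j) \<le> 9 * L * (1 / real i * (1 / real j)) + (if i = j then 3 * L * (1 / real i) else 0)"
    if ij: "i \<in> J" "j \<in> J" for i j
  proof -
    have K: "K1 \<le> i" "K1 \<le> j" using ij by (auto simp: J_def)
    have *: "measure lebesgue (A i \<inter> A j) \<le> 9 * L * (1 / real i * (1 / real j))"
      if "i < j" "K1 \<le> i" for i j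
    proof -
      have "A i \<inter> A j = farey_nbhd i \<inter> farey_nbhd j \<inter> {a..b}" by (auto simp: A_def)
      then show ?thesis
        using measure_farey_nbhd_Int_le[OF big(1)[OF that(2)] that(1) ab] big(5)[OF that(2)]
        by (simp add: L_def)
    qed
    consider "i < j" | "j < i" | "i = j" by linarith
    then show ?thesis
    proof cases
      case 1 then show ?thesis using *[OF 1 K(1)] by simp
    next
      case 2 then show ?thesis using *[OF 2 K(2)] by (simp add: Int_commute mult.commute)
    next
      case 3
      have "measure lebesgue (A i) \<le> 3 * L * (1 / real i)"
        using measure_farey_nbhd_le[OF big(1)[OF K(1)] ab] big(5)[OF K(1)] by (simp add: A_def L_def)
      moreover have "0 \<le> 9 * L * (1 / real i * (1 / real j))" using L by simp
      ultimately show ?thesis using 3 by simp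
    qed
  qed
  have "(\<Sum>i\<in>J. \<Sum>j\<in>J. measure lebesgue (A i \<inter> A j))
      \<le> (\<Sum>i\<in>J. \<Sum>j\<in>J. 9 * L * (1 / real i * (1 / real j)) + (if i = j then 3 * L * (1 / real i) else 0))"
    by (intro sum_mono pair)
  also have "\<dots> = 9 * L * (h * h) + 3 * L * h"
    unfolding h(2) sum_product by (simp add: sum.distrib sum_distrib_left J_def)
  also have "\<dots> \<le> 12 * L * (h * h)"
  proof -
    have "3 * L * h * 1 \<le> 3 * L * h * h" using h L by (intro mult_left_mono) auto
    then show ?thesis by (simp add: algebra_simps)
  qed
  finally have upper: "(\<Sum>i\<in>J. \<Sum>j\<in>J. measure lebesgue (A i \<inter> A j)) \<le> 12 * L * (h * h)" .
  \<comment> \<open>The quotient of the two moment bounds,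
    \<open>(L * h / 256) / (12 * L * h^2)\<close>, which maximises the lower bound.\<close>
  define t where "t = 1 / (3072 * h)"
  have "L / 786432 = 2 * t * (L / 256 * h) - t\<^sup>2 * (12 * L * (h * h))"
    using h(1) by (simp add: t_def field_simps power2_eq_square)
  also have "\<dots> \<le> 2 * t * (\<Sum>k\<in>J. measure lebesgue (A k)) - t\<^sup>2 * (\<Sum>i\<in>J. \<Sum>j\<in>J. measure lebesgue (A i \<inter> A j))"
    using lower upper h(1) by (intro diff_mono mult_left_mono) (auto simp: t_def)
  also have "\<dots> \<le> measure lebesgue (\<Union>k\<in>J. A k)"
    using Am by (intro measure_UN_ge_second_moment) (auto simp: J_def)
  also have "\<dots> \<le> measure lebesgue ((\<Union>k\<in>{K..}. farey_nbhd k) \<inter> {a..b})"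
  proof (intro measure_mono_fmeasurable)
    show "(\<Union>k\<in>J. A k) \<subseteq> (\<Union>k\<in>{K..}. farey_nbhd k) \<inter> {a..b}"
      using big(2) by (fastforce simp: A_def J_def)
    show "(\<Union>k\<in>{K..}. farey_nbhd k) \<inter> {a..b} \<in> lmeasurable"
      by (intro bounded_set_imp_lmeasurable) (auto intro: bounded_subset[OF bounded_closed_interval])
    show "(\<Union>k\<in>J. A k) \<in> sets lebesgue" using Am by (auto simp: J_def dest!: fmeasurableD)
  qed
  finally show ?thesis by (simp add: L_def)
qed

text \<open>For each \<open>K\<close> the points missed by all scales from \<open>K\<close> on have
  density bounded away from 1 in every interval, hence form a null set; the exceptional set is the
  countable union of these.\<close>

lemma negligible_not_infinitely_often_farey_nbhd:
  "negligible {x \<in> {0..1}. \<not> (\<forall>K. \<exists>k\<ge>K. x \<in> farey_nbhd k)}"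
proof -
  define F where "F = (\<lambda>K. {0..1} - (\<Union>k\<in>{K..}. farey_nbhd k))"
  have "negligible (F K)" for K
  proof (rule negligible_density_bounded[where u=0 and v=1 and \<theta>="1 - 1 / 786432"])
    define G where "G = (\<Union>k\<in>{K..}. farey_nbhd k)"
    have G: "G \<in> sets lebesgue" by (auto simp: G_def)
    have FG: "F K = {0..1} - G" by (simp add: F_def G_def)
    show "F K \<in> sets lebesgue" unfolding FG using G by (intro sets.Diff) auto
    fix a b :: real assume ab: "a < b"
    have GI: "G \<inter> {a..b} \<in> lmeasurable"
      using G by (intro bounded_set_imp_lmeasurable) (auto intro: bounded_subset[OF bounded_closed_interval])
    have "measure lebesgue (F K \<inter> {a..b}) \<le> measure lebesgue ({a..b} - G \<inter> {a..b})"
      unfolding FG using G GI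
      by (intro measure_mono_fmeasurable sets.Int sets.Diff fmeasurable_Diff) (auto dest!: fmeasurableD)
    also have "\<dots> = measure lebesgue {a..b} - measure lebesgue (G \<inter> {a..b})"
      using GI by (intro measurable_measure_Diff) (auto dest!: fmeasurableD)
    also have "\<dots> \<le> (b - a) - (b - a) / 786432"
      using measure_UN_farey_nbhd_ge[OF ab, of K] ab by (simp add: G_def)
    finally show "measure lebesgue (F K \<inter> {a..b}) \<le> (1 - 1 / 786432) * (b - a)"
      by (simp add: field_simps)
  qed (auto simp: F_def)
  then have "negligible (\<Union>K. F K)" by (intro negligible_countable_Union) auto
  moreover have "{x \<in> {0..1}. \<not> (\<forall>K. \<exists>k\<ge>K. x \<in> farey_nbhd k)} = (\<Union>K. F K)"
    by (auto simp: F_def)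
  ultimately show ?thesis by simp
qed

section \<open>Excursions into the cusp\<close>

lemma ln_le_arcosh_real: "ln v \<le> arcosh v" if "1 \<le> v" for v :: real
proof -
  have "0 \<le> sqrt (v\<^sup>2 - 1)" using that by simp
  then have "ln v \<le> ln (v + sqrt (v\<^sup>2 - 1))" using that by (intro ln_mono) auto
  then show ?thesis using that by (simp add: arcosh_real_def)
qed

text \<open>\<open>Im Z / |Z|^2\<close> is the imaginary part of \<open>-1 / Z\<close>, so the
  difference is at most the modulus of \<open>1 / W - 1 / Z\<close>.\<close>

lemma Im_div_norm_square_diff_le:
  assumes "Z \<noteq> 0" "W \<noteq> 0"
  shows "\<bar>Im Z / (cmod Z)\<^sup>2 - Im W / (cmod W)\<^sup>2\<bar> \<le> cmod (Z - W) / (cmod Z * cmod W)"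
proof -
  have "Im Z / (cmod Z)\<^sup>2 - Im W / (cmod W)\<^sup>2 = Im (1 / W - 1 / Z)"
    by (simp add: Im_divide cmod_power2)
  also have "\<bar>Im (1 / W - 1 / Z)\<bar> \<le> cmod (1 / W - 1 / Z)"
    by (rule abs_Im_le_cmod)
  also have "1 / W - 1 / Z = (Z - W) / (Z * W)"
    using assms by (simp add: field_simps)
  finally show ?thesis
    by (simp add: norm_divide norm_mult)
qed

text \<open>\<open>Y u\<close> is the height of the image of \<open>u\<close> under a real matrix of
  determinant 1 with bottom row \<open>(c, d)\<close>, and the distance between two points is at
  least the log ratio of their heights. The direct estimate avoids completing the matrix and applies
  to any real row with \<open>c \<noteq> 0\<close>.\<close>

lemma hdist_ge_ln_ratio:
  fixes c d :: real and z w :: complex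
  defines "Y \<equiv> \<lambda>u. Im u / (cmod (of_real c * u + of_real d))\<^sup>2"
  assumes c: "c \<noteq> 0" and z: "Im z > 0" and w: "Im w > 0"
  shows "ln (Y z / Y w) - ln 2 \<le> hdist w z"
proof -
  define Z where "Z = of_real c * z + of_real d"
  define W where "W = of_real c * w + of_real d"
  have IZ: "Im Z = c * Im z" and IW: "Im W = c * Im w"
    by (simp_all add: Z_def W_def)
  then have nz: "Z \<noteq> 0" "W \<noteq> 0" using c z w by auto
  have diff: "Z - W = of_real c * (z - w)"
    by (simp add: Z_def W_def algebra_simps)
  \<comment> \<open>The factor \<open>c\<close> turns \<open>Y\<close> into
    \<open>Im Z / |Z|^2\<close>, and it cancels again because \<open>Z - W\<close> carries the same
    factor.\<close>
  have "\<bar>c\<bar> * \<bar>Y z - Y w\<bar> = \<bar>Im Z / (cmod Z)\<^sup>2 - Im W / (cmod W)\<^sup>2\<bar>"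
    unfolding IZ IW abs_mult[symmetric]
    by (simp add: Y_def Z_def W_def algebra_simps)
  also have "\<dots> \<le> \<bar>c\<bar> * (cmod (z - w) / (cmod Z * cmod W))"
    using Im_div_norm_square_diff_le[OF nz] by (simp add: diff norm_mult)
  finally have "\<bar>Y z - Y w\<bar> \<le> cmod (z - w) / (cmod Z * cmod W)"
    using c by (metis mult_le_cancel_left_pos zero_less_abs_iff)
  then have "\<bar>Y z - Y w\<bar>\<^sup>2 \<le> (cmod (z - w) / (cmod Z * cmod W))\<^sup>2"
    by (rule power_mono) simp
  then have sq: "(Y z - Y w)\<^sup>2 \<le> (cmod (z - w))\<^sup>2 / ((cmod Z)\<^sup>2 * (cmod W)\<^sup>2)"
    by (simp add: power_divide power_mult_distrib)
  have Y: "Y z > 0" "Y w > 0"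
    using nz z w by (simp_all add: Y_def Z_def W_def)
  have prod: "Y z * Y w = Im z * Im w / ((cmod Z)\<^sup>2 * (cmod W)\<^sup>2)"
    by (simp add: Y_def Z_def W_def)
  have "(Y z - Y w)\<^sup>2 / (Y z * Y w) \<le>
      ((cmod (z - w))\<^sup>2 / ((cmod Z)\<^sup>2 * (cmod W)\<^sup>2)) / (Y z * Y w)"
    using sq Y by (intro divide_right_mono) auto
  also have "\<dots> = (cmod (z - w))\<^sup>2 / (Im z * Im w)"
    unfolding prod using nz by (simp add: field_simps)
  finally have main: "(Y z - Y w)\<^sup>2 / (Y z * Y w) \<le> (cmod (z - w))\<^sup>2 / (Im z * Im w)" .
  have "(Y z - Y w)\<^sup>2 / (Y z * Y w) = Y z / Y w + Y w / Y z - 2"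
    using Y by (simp add: field_simps power2_eq_square)
  moreover have "Y w / Y z > 0" using Y by simp
  \<comment> \<open>Half the sum of the height ratio and its inverse is the hyperbolic cosine of the
    log ratio; dropping the inverse costs the \<open>ln 2\<close>.\<close>
  ultimately have "Y z / Y w / 2 \<le> 1 + (cmod (w - z))\<^sup>2 / (2 * Im w * Im z)"
    using main by (simp add: norm_minus_commute mult.commute field_simps)
  then have "ln (Y z / Y w / 2) \<le> ln (1 + (cmod (w - z))\<^sup>2 / (2 * Im w * Im z))"
    using Y by (intro ln_mono) auto
  also have "\<dots> \<le> hdist w z"
    unfolding hdist_def using z w by (intro ln_le_arcosh_real) simp
  finally show ?thesis using Y by (simp add: ln_div ln_mult)
qed

text \<open>If \<open>m = 0\<close> the denominator is at least 1, and otherwise its modulus is at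
  least \<open>Im z\<close>.\<close>

lemma cusp_height_le:
  fixes m k :: int
  assumes z: "Im z > 0" and mk: "m \<noteq> 0 \<or> k \<noteq> 0"
  shows "Im z / (cmod (of_int m * z + of_int k))\<^sup>2 \<le> max (Im z) (1 / Im z)"
proof (cases "m = 0")
  case True
  with mk have "1 \<le> \<bar>k\<bar>" by simp
  then have "1 \<le> (real_of_int k)^2"
    by (metis of_int_1_le_iff of_int_abs one_le_power power2_abs)
  then have "Im z / (cmod (of_int m * z + of_int k))\<^sup>2 \<le> Im z"
    using z True by (simp add: divide_le_eq mult_le_cancel_left1 split: if_splits)
  then show ?thesis by simp
next
  case False
  then have "1 \<le> \<bar>m\<bar>" by simp
  then have m: "1 \<le> (real_of_int m)^2"
    by (metis of_int_1_le_iff of_int_abs one_le_power power2_abs)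
  have "(Im z)\<^sup>2 \<le> (real_of_int m * Im z)\<^sup>2"
    using m by (simp add: power_mult_distrib mult_le_cancel_right1)
  also have "\<dots> \<le> (cmod (of_int m * z + of_int k))\<^sup>2"
    by (simp add: cmod_power2)
  finally have "Im z / (cmod (of_int m * z + of_int k))\<^sup>2 \<le> Im z / (Im z)\<^sup>2"
    using z by (intro divide_left_mono) (auto intro!: mult_pos_pos simp: zero_less_power2)
  also have "\<dots> = 1 / Im z" using z by (simp add: power2_eq_square)
  finally show ?thesis by simp
qed

text \<open>Moving \<open>z\<close> by \<open>g\<close> multiplies the row \<open>(c, d)\<close> by
  \<open>g\<close> from the right, giving again a nonzero integer row \<open>(m, k)\<close>. The
  bound is therefore uniform over the orbit, and it holds for rows that are not coprime, as
  unreduced fractions require.\<close>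

lemma moebius_act_cusp_height:
  fixes c d :: int
  assumes g: "g \<in> SL2Z" and z: "Im z > 0" and cd: "c \<noteq> 0 \<or> d \<noteq> 0"
  defines "w \<equiv> moebius_act g z"
  shows "Im w > 0" "Im w / (cmod (of_int c * w + of_int d))\<^sup>2 \<le> max (Im z) (1 / Im z)"
proof -
  obtain a b c' d' where gg: "g = (a,b,c',d')" by (cases g) auto
  have det: "a * d' - b * c' = 1" using g by (simp add: SL2Z_def gg)
  define N where "N = of_int c' * z + of_int d'"
  have w: "w = (of_int a * z + of_int b) / N"
    by (simp add: w_def moebius_act_def gg N_def)
  have N0: "N \<noteq> 0"
  proof
    assume "N = 0"
    then have "Re N = 0" "Im N = 0" by auto
    then have "c' = 0" "d' = 0" using z by (auto simp: N_def)
    then show False using det by simp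
  qed
  have dR: "real_of_int a * of_int d' - of_int b * of_int c' = 1"
    using det by (metis of_int_1 of_int_diff of_int_mult)
  have "Im w = ((real_of_int a * of_int d' - of_int b * of_int c') * Im z) / (cmod N)\<^sup>2"
    by (simp add: w Im_divide N_def cmod_power2) (simp add: algebra_simps)
  then have Imw: "Im w = Im z / (cmod N)\<^sup>2" by (simp add: dR)
  then show "Im w > 0" using z N0 by simp
  define m where "m = c * a + d * c'"
  define k where "k = c * b + d * d'"
  have "of_int c * w + of_int d = (of_int m * z + of_int k) / N"
    using N0 by (simp add: w field_simps) (simp add: N_def m_def k_def algebra_simps)
  then have "Im w / (cmod (of_int c * w + of_int d))\<^sup>2 = Im z / (cmod (of_int m * z + of_int k))\<^sup>2"
    using N0 by (simp add: Imw norm_divide power_divide)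
  moreover have "m \<noteq> 0 \<or> k \<noteq> 0"
  proof (rule ccontr)
    assume "\<not> ?thesis"
    \<comment> \<open>The inverse of \<open>g\<close> recovers \<open>(c, d)\<close> from
      \<open>(m, k)\<close>, as the determinant is 1.\<close>
    then have "m * d' - k * c' = 0" "k * a - m * b = 0" by auto
    moreover have "m * d' - k * c' = c * (a * d' - b * c')" "k * a - m * b = d * (a * d' - b * c')"
      by (simp_all add: m_def k_def algebra_simps)
    ultimately show False using det cd by simp
  qed
  ultimately show "Im w / (cmod (of_int c * w + of_int d))\<^sup>2 \<le> max (Im z) (1 / Im z)"
    using cusp_height_le[OF z] by metis
qed

text \<open>The orbit of \<open>z0\<close> has bounded height with respect to every integer row, so
  a point high up for some row is far from the whole orbit, with a loss depending on
  \<open>z0\<close> alone.\<close>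

lemma dM_ge:
  fixes c d :: int
  assumes z0: "Im z0 > 0" and z: "Im z > 0" and c: "c \<noteq> 0"
  shows "ln (Im z / (cmod (of_int c * z + of_int d))\<^sup>2) - ln 2 - ln (max (Im z0) (1 / Im z0))
    \<le> dM z0 z"
  unfolding dM_def
proof (rule cINF_greatest)
  have "(1,0,0,1) \<in> SL2Z" by (simp add: SL2Z_def)
  then show "SL2Z \<noteq> {}" by blast
next
  fix g assume g: "g \<in> SL2Z"
  define w where "w = moebius_act g z0"
  define Y where "Y = (\<lambda>u. Im u / (cmod (of_int c * u + of_int d))\<^sup>2)"
  have w: "Im w > 0" "Y w \<le> max (Im z0) (1 / Im z0)"
    unfolding Y_def w_def using moebius_act_cusp_height[OF g z0] c by auto
  have pos: "Im u > 0 \<Longrightarrow> Y u > 0" for u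
  proof -
    assume u: "Im u > 0"
    have "Im (of_int c * u + of_int d) \<noteq> 0" using c u by simp
    then have "of_int c * u + of_int d \<noteq> 0" by (metis zero_complex.simps(2))
    then show "Y u > 0" using u by (simp add: Y_def)
  qed
  have "ln (Y w) \<le> ln (max (Im z0) (1 / Im z0))"
    using w pos by (metis ln_mono)
  moreover have "ln (Y z / Y w) - ln 2 \<le> hdist w z"
    using hdist_ge_ln_ratio[of "of_int c" z w "of_int d"] c z w(1) by (simp add: Y_def)
  moreover have "ln (Y z / Y w) = ln (Y z) - ln (Y w)"
    using pos[OF z] pos[OF w(1)] by (simp add: ln_div)
  ultimately show "ln (Im z / (cmod (of_int c * z + of_int d))\<^sup>2) - ln 2 - ln (max (Im z0) (1 / Im z0))
      \<le> hdist (moebius_act g z0) z"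
    by (simp add: Y_def w_def)
qed

text \<open>For the \<open>j\<close>-th point the row \<open>(n, -(a + j))\<close> is used: the
  value \<open>n * (x - a / n + i * y)\<close> does not depend on \<open>j\<close>, so one bound
  serves all points.\<close>

lemma INF_dM_Rn_ge:
  fixes a :: int
  assumes z0: "Im z0 > 0" and y: "y > 0" and n: "n > 0"
    and x: "\<bar>x - of_int a / real n\<bar> \<le> \<delta>"
  shows "ln (y / ((real n)\<^sup>2 * (y\<^sup>2 + \<delta>\<^sup>2))) - ln 2 - ln (max (Im z0) (1 / Im z0))
    \<le> (INF z\<in>Rn n x y. dM z0 z)"
proof (rule cINF_greatest)
  show "Rn n x y \<noteq> {}" using n by (auto simp: Rn_def)
next
  fix z assume "z \<in> Rn n x y"
  then obtain j where z: "z = Complex (x + real j / real n) y" by (auto simp: Rn_def)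
  have "of_int (int n) * z + of_int (- (a + int j)) = of_nat n * Complex (x - of_int a / real n) y"
    using n by (simp add: complex_eq_iff z field_simps)
  then have "(cmod (of_int (int n) * z + of_int (- (a + int j))))\<^sup>2
      = (real n)\<^sup>2 * (y\<^sup>2 + (x - of_int a / real n)\<^sup>2)"
    by (simp add: norm_mult power_mult_distrib cmod_power2)
  also have "\<dots> \<le> (real n)\<^sup>2 * (y\<^sup>2 + \<delta>\<^sup>2)"
    using x by (intro mult_left_mono add_left_mono) (auto simp: abs_le_square_iff[symmetric])
  finally have le: "(cmod (of_int (int n) * z + of_int (- (a + int j))))\<^sup>2 \<le> (real n)\<^sup>2 * (y\<^sup>2 + \<delta>\<^sup>2)" .
  have "Im (of_int (int n) * z + of_int (- (a + int j))) \<noteq> 0" using n y by (simp add: z)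
  then have nz: "of_int (int n) * z + of_int (- (a + int j)) \<noteq> 0" by (metis zero_complex.simps(2))
  have "y\<^sup>2 + \<delta>\<^sup>2 > 0" using y by (simp add: add_pos_nonneg)
  then have "ln (y / ((real n)\<^sup>2 * (y\<^sup>2 + \<delta>\<^sup>2)))
      \<le> ln (Im z / (cmod (of_int (int n) * z + of_int (- (a + int j))))\<^sup>2)"
    using le nz y n by (subst ln_le_cancel_iff) (auto simp: z intro!: divide_left_mono mult_pos_pos divide_pos_pos simp: zero_less_power2)
  then show "ln (y / ((real n)\<^sup>2 * (y\<^sup>2 + \<delta>\<^sup>2))) - ln 2 - ln (max (Im z0) (1 / Im z0)) \<le> dM z0 z"
    using dM_ge[OF z0, of z "int n" "- (a + int j)"] n y by (simp add: z)
qed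

section \<open>Logarithmic bookkeeping\<close>

text \<open>From \<open>q \<le> k^k\<close> follows \<open>ln (ln q) \<le> ln k + ln (ln k)\<close>,
  which is \<open>ln k\<close> up to a factor close to 1. So the gain \<open>k\<close> in the
  approximation is nearly a full power of \<open>ln q\<close>.\<close>

lemma farey_denominator_ln_ln:
  fixes \<epsilon> B :: real
  assumes \<epsilon>: "0 < \<epsilon>" "\<epsilon> < 1"
  shows "\<forall>\<^sub>F k in sequentially. \<forall>q::nat. fact k < 8 * q \<and> q \<le> fact k \<longrightarrow>
    B < ln (ln (real q)) \<and> (1 - \<epsilon>) * ln (ln (real q)) \<le> ln (real k)"
proof -
  have "filterlim (\<lambda>k. ln (ln (real k / 8))) at_top sequentially" by real_asymp
  then have "\<forall>\<^sub>F k in sequentially. B < ln (ln (real k / 8))"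
    by (simp add: filterlim_at_top_dense)
  moreover have "((\<lambda>k. ln (ln (real k)) / ln (real k)) \<longlongrightarrow> 0) sequentially" by real_asymp
  then have "\<forall>\<^sub>F k in sequentially. ln (ln (real k)) / ln (real k) < \<epsilon>"
    using \<epsilon>(1) by (rule order_tendstoD)
  \<comment> \<open>Then \<open>k / 8\<close> is at least 3, hence at least \<open>exp 1\<close>,
    and the inner logarithms are at least 1.\<close>
  moreover have "\<forall>\<^sub>F k::nat in sequentially. 24 \<le> k" by (rule eventually_ge_at_top)
  ultimately show ?thesis
  proof eventually_elim
    case (elim k)
    note k = elim(3)
    have lnk: "1 \<le> ln (real k / 8)" "1 \<le> ln (real k)"
      using k exp_le by (subst ln_ge_iff; linarith)+
    show ?case
    proof (intro allI impI)
      fix q :: nat assume q: "fact k < 8 * q \<and> q \<le> fact k"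
      have "k \<le> fact k" by (rule fact_ge_self)
      then have "k \<le> 8 * q" using q by linarith
      then have kq: "real k / 8 \<le> real q" by simp
      have q0: "0 < real k / 8" using k by simp
      have l1: "ln (real k / 8) \<le> ln (real q)" using kq q0 by (simp add: ln_mono)
      then have l2: "ln (ln (real k / 8)) \<le> ln (ln (real q))" by (rule ln_mono) (use lnk in linarith)
      have "real q \<le> real (k ^ k)"
        unfolding of_nat_le_iff using q fact_le_power[of k, where ?'a=nat] by simp
      then have "ln (real q) \<le> ln (real k ^ k)" using kq q0 by (intro ln_mono) auto
      also have "\<dots> = real k * ln (real k)" using k by (simp add: ln_realpow)
      finally have "ln (ln (real q)) \<le> ln (real k * ln (real k))"
        using l1 lnk by (intro ln_mono) auto
      also have "\<dots> = ln (real k) + ln (ln (real k))" using k lnk by (simp add: ln_mult)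
      also have "\<dots> \<le> (1 + \<epsilon>) * ln (real k)"
        using elim(2) lnk by (simp add: field_simps)
      finally have "(1 - \<epsilon>) * ln (ln (real q)) \<le> (1 - \<epsilon>) * ((1 + \<epsilon>) * ln (real k))"
        using \<epsilon> by (intro mult_left_mono) auto
      also have "\<dots> = ln (real k) - \<epsilon>\<^sup>2 * ln (real k)"
        by (simp add: algebra_simps power2_eq_square)
      also have "\<dots> \<le> ln (real k)" using lnk by simp
      finally show "B < ln (ln (real q)) \<and> (1 - \<epsilon>) * ln (ln (real q)) \<le> ln (real k)"
        using elim(1) l2 by auto
    qed
  qed
qed

text \<open>With \<open>Y = n^2 * y\<close> the height is \<open>Y / (Y^2 + 1 / k^2)\<close>, up to
  a factor 2 the smaller of \<open>1 / Y\<close> and \<open>k^2 * Y\<close>. The upper bound on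
  \<open>y\<close> controls the first, the lower bound the second; \<open>ln k\<close> close to
  \<open>\<omega>\<close> then yields the exponents \<open>\<beta>\<close> and
  \<open>2 - \<beta>\<close>.\<close>

lemma ln_cusp_height_ge:
  fixes y c C \<beta> :: real
  assumes cC: "0 < c" "0 < C" and n: "0 < n" and l: "0 < ln (real n)" and k: "0 < k"
    and y: "c / (real n ^ 2 * ln (real n) powr \<beta>) \<le> y" "y \<le> C / (real n ^ 2 * ln (real n) powr \<beta>)"
  defines "\<omega> \<equiv> ln (ln (real n))"
  shows "min (\<beta> * \<omega> - ln C) (ln c - \<beta> * \<omega> + 2 * ln (real k)) - ln 2
    \<le> ln (y / ((real n)\<^sup>2 * (y\<^sup>2 + (1 / (real k * (real n)\<^sup>2))\<^sup>2)))"
proof -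
  define Y where "Y = (real n)\<^sup>2 * y"
  define p where "p = ln (real n) powr \<beta>"
  have p: "p > 0" "ln p = \<beta> * \<omega>" using l by (auto simp: p_def \<omega>_def ln_powr)
  have n2: "(real n)\<^sup>2 > 0" using n by simp
  have "c / p \<le> Y" "Y \<le> C / p"
    using y n2 p(1) unfolding Y_def p_def[symmetric] by (simp_all add: field_simps)
  moreover have "c / p > 0" using cC p by simp
  ultimately have Y: "Y > 0" "ln (c / p) \<le> ln Y" "ln Y \<le> ln (C / p)"
    by (auto intro: ln_mono)
  have lnY: "ln c - \<beta> * \<omega> \<le> ln Y" "ln Y \<le> ln C - \<beta> * \<omega>"
    using Y(2,3) cC p by (simp_all add: ln_div)
  have eq: "y / ((real n)\<^sup>2 * (y\<^sup>2 + (1 / (real k * (real n)\<^sup>2))\<^sup>2)) = Y / (Y\<^sup>2 + (1 / real k)\<^sup>2)"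
  proof -
    define m where "m = (real n)\<^sup>2"
    have "m > 0" using n2 by (simp add: m_def)
    then have "m * (y\<^sup>2 + (1 / (real k * m))\<^sup>2) = (Y\<^sup>2 + (1 / real k)\<^sup>2) / m"
      using k by (simp add: Y_def flip: m_def) (simp add: field_simps power2_eq_square)
    then show ?thesis using \<open>m > 0\<close> by (simp add: Y_def flip: m_def)
  qed
  have "ln (Y\<^sup>2 + (1 / real k)\<^sup>2) \<le> ln (2 * max (Y\<^sup>2) ((1 / real k)\<^sup>2))"
    using Y by (intro ln_mono) (auto simp: max_def add_pos_nonneg)
  also have "\<dots> = ln 2 + max (2 * ln Y) (- 2 * ln (real k))"
  proof -
    have "ln (max (Y\<^sup>2) ((1 / real k)\<^sup>2)) = max (ln (Y\<^sup>2)) (ln ((1 / real k)\<^sup>2))"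
      using Y k by (auto simp: max_def)
    moreover have "ln (Y\<^sup>2) = 2 * ln Y" "ln ((1 / real k)\<^sup>2) = - 2 * ln (real k)"
      using Y(1) k by (simp_all add: ln_realpow ln_div)
    moreover have "max (Y\<^sup>2) ((1 / real k)\<^sup>2) > 0" using Y(1) by (simp add: less_max_iff_disj)
    ultimately show ?thesis by (simp only: ln_mult_pos zero_less_numeral)
  qed
  finally have "ln (Y\<^sup>2 + (1 / real k)\<^sup>2) \<le> ln 2 + max (2 * ln Y) (- 2 * ln (real k))" .
  moreover have "ln (Y / (Y\<^sup>2 + (1 / real k)\<^sup>2)) = ln Y - ln (Y\<^sup>2 + (1 / real k)\<^sup>2)"
    using Y(1) by (intro ln_divide_pos) (auto simp: add_pos_nonneg)
  ultimately show ?thesis unfolding eq using lnY by linarith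
qed

section \<open>Lower bound for the limsup along approximating denominators\<close>

theorem theorem1p4:
  fixes z0 :: complex and y :: "nat \<Rightarrow> real" and \<beta> :: real
  assumes "z0 \<in> upper_half"
    and "\<And>n. y n > 0"
    and "0 < \<beta>" and "\<beta> < 2"
    and "\<exists>c C. c > 0 \<and> C > 0 \<and> (\<forall>n\<ge>2.
            c / (real n ^ 2 * ln (real n) powr \<beta>) \<le> y n \<and>
            y n \<le> C / (real n ^ 2 * ln (real n) powr \<beta>))"
  shows "AE x in lebesgue_on {0..1}.
           limsup (\<lambda>n. ereal ((INF z\<in>Rn n x (y n). dM z0 z) / ln (ln (real n))))
             \<ge> ereal (min \<beta> (2 - \<beta>))"
proof -
  have z0: "Im z0 > 0" using assms(1) by (simp add: upper_half_def)
  obtain c C where cC: "c > 0" "C > 0" and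
    yb: "\<And>n. n \<ge> 2 \<Longrightarrow> c / (real n ^ 2 * ln (real n) powr \<beta>) \<le> y n"
        "\<And>n. n \<ge> 2 \<Longrightarrow> y n \<le> C / (real n ^ 2 * ln (real n) powr \<beta>)"
    using assms(5) by blast
  define \<mu> where "\<mu> = min \<beta> (2 - \<beta>)"
  define f where "f = (\<lambda>x n. (INF z\<in>Rn n x (y n). dM z0 z) / ln (ln (real n)))"
  have freq: "\<exists>\<^sub>F n in sequentially. r < f x n"
    if x: "\<forall>K. \<exists>k\<ge>K. x \<in> farey_nbhd k" and r: "r < \<mu>" for x r
  proof -
    \<comment> \<open>The gap \<open>\<mu> - r\<close> is split in two: half covers the loss
      \<open>2 * \<epsilon>\<close> in the exponent, the other half, through \<open>B\<close>, the
      additive constants collected in \<open>C1\<close>.\<close>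
    define \<epsilon> where "\<epsilon> = min (1/2) ((\<mu> - r) / 4)"
    have \<epsilon>: "0 < \<epsilon>" "\<epsilon> < 1" "4 * \<epsilon> \<le> \<mu> - r" using r by (auto simp: \<epsilon>_def min_def)
    define C1 where "C1 = \<bar>ln C\<bar> + \<bar>ln c\<bar> + ln 2 + ln 2 + \<bar>ln (max (Im z0) (1 / Im z0))\<bar>"
    define B where "B = max 0 (C1 / (\<mu> - r) * 2)"
    obtain K0 where K0: "\<And>k q. k \<ge> K0 \<Longrightarrow> fact k < 8 * q \<Longrightarrow> q \<le> fact k \<Longrightarrow>
        B < ln (ln (real q)) \<and> (1 - \<epsilon>) * ln (ln (real q)) \<le> ln (real k)" for q :: nat
      using farey_denominator_ln_ln[OF \<epsilon>(1,2), of B] unfolding eventually_sequentially by blast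
    show ?thesis
      unfolding frequently_sequentially
    proof
      fix N
      \<comment> \<open>As \<open>q > k! / 8 \<ge> k / 8\<close>, the summand \<open>8 * N\<close>
        ensures \<open>q \<ge> N\<close>.\<close>
      obtain k where k: "k \<ge> Suc (K0 + 8 * N)" "x \<in> farey_nbhd k" using x by blast
      then obtain p q where q: "fact k < 8 * q" "q \<le> fact k"
        and close: "\<bar>of_int p / real q - x\<bar> < farey_radius k"
        by (auto simp: farey_nbhd_def farey_points_def dist_real_def)
      have k0: "0 < k" using k by simp
      have "k \<le> fact k" by (rule fact_ge_self)
      then have "N \<le> q" using k q by linarith
      define l where "l = ln (ln (real q))"
      have l: "B < l" "(1 - \<epsilon>) * l \<le> ln (real k)" using K0[of k q] k q by (auto simp: l_def)
      have l0: "0 < l" "C1 / (\<mu> - r) * 2 < l" using l(1) by (auto simp: B_def)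
      have q0: "0 < q" using q by (intro gr0I) auto
      \<comment> \<open>For \<open>q = 1\<close> the inner logarithm is 0 and
        \<open>ln 0 = 0\<close>, which contradicts \<open>l > 0\<close>; so
        \<open>q \<ge> 2\<close>, where the bounds on \<open>y\<close> are available.\<close>
      have lnq: "0 < ln (real q)"
      proof (rule ccontr)
        assume "\<not> ?thesis"
        moreover have "0 \<le> ln (real q)" using q0 by simp
        ultimately have "ln (real q) = 0" by linarith
        then show False using l0 by (simp add: l_def)
      qed
      then have q2: "2 \<le> q" using q0 by (cases "q = 1") auto
      have "real k * (real q)\<^sup>2 \<le> 2 * real k * (fact k)\<^sup>2"
      proof -
        have "real q \<le> fact k" using q(2) by (metis of_nat_fact of_nat_le_iff)
        then have "(real q)\<^sup>2 \<le> (fact k)\<^sup>2" by (intro power_mono) auto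
        then have "real k * (real q)\<^sup>2 \<le> real k * (fact k)\<^sup>2" by (intro mult_left_mono) auto
        moreover have "0 \<le> real k * (fact k)\<^sup>2" by simp
        ultimately show ?thesis by linarith
      qed
      then have "farey_radius k \<le> 1 / (real k * (real q)\<^sup>2)"
        unfolding farey_radius_def using k0 q0 by (intro divide_left_mono) auto
      then have d: "\<bar>x - of_int p / real q\<bar> \<le> 1 / (real k * (real q)\<^sup>2)"
        using close by linarith
      have "min (\<beta> * l - ln C) (ln c - \<beta> * l + 2 * ln (real k)) - ln 2 - ln 2
          - ln (max (Im z0) (1 / Im z0)) \<le> (INF z\<in>Rn q x (y q). dM z0 z)"
        using INF_dM_Rn_ge[OF z0 assms(2)[of q] q0 d]
          ln_cusp_height_ge[OF cC q0 lnq k0 yb[OF q2]] unfolding l_def by linarith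
      moreover have "(\<mu> - 2 * \<epsilon>) * l - (\<bar>ln C\<bar> + \<bar>ln c\<bar>)
          \<le> min (\<beta> * l - ln C) (ln c - \<beta> * l + 2 * ln (real k))"
      proof -
        have "\<mu> * l \<le> \<beta> * l" "\<mu> * l \<le> (2 - \<beta>) * l"
          using l0 by (auto simp: \<mu>_def intro!: mult_right_mono)
        moreover have "0 \<le> \<epsilon> * l" using \<epsilon> l0 by simp
        moreover have "l - \<epsilon> * l \<le> ln (real k)" using l(2) by (simp add: algebra_simps)
        moreover have "(\<mu> - 2 * \<epsilon>) * l = \<mu> * l - 2 * (\<epsilon> * l)" "(2 - \<beta>) * l = 2 * l - \<beta> * l"
          by (simp_all add: algebra_simps)
        ultimately show ?thesis by linarith
      qed
      ultimately have "(\<mu> - 2 * \<epsilon>) * l - C1 \<le> (INF z\<in>Rn q x (y q). dM z0 z)"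
        unfolding C1_def by linarith
      moreover have "r * l < (\<mu> - 2 * \<epsilon>) * l - C1"
      proof -
        have "2 * C1 < (\<mu> - r) * l" using l0(2) r by (simp add: field_simps)
        moreover have "4 * \<epsilon> * l \<le> (\<mu> - r) * l" using \<epsilon> l0 by (intro mult_right_mono) auto
        ultimately show ?thesis by (simp add: algebra_simps)
      qed
      ultimately have "r < f x q" using l0 by (simp add: f_def pos_less_divide_eq flip: l_def)
      then show "\<exists>n\<ge>N. r < f x n" using \<open>N \<le> q\<close> by blast
    qed
  qed
  \<comment> \<open>Otherwise some real \<open>r\<close> would lie strictly between the limsup and
    \<open>\<mu>\<close>, and \<open>f x n\<close> would eventually not exceed it.\<close>
  have main: "ereal \<mu> \<le> limsup (\<lambda>n. ereal (f x n))"
    if x: "\<forall>K. \<exists>k\<ge>K. x \<in> farey_nbhd k" for x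
  proof (rule ccontr)
    assume "\<not> ?thesis"
    then obtain r where r: "limsup (\<lambda>n. ereal (f x n)) < ereal r" "r < \<mu>"
      using ereal_dense2[of "limsup (\<lambda>n. ereal (f x n))" "ereal \<mu>"] by (auto simp: not_le)
    then have "\<forall>\<^sub>F n in sequentially. \<not> r < f x n"
      using Limsup_lessD[OF r(1)] by (auto elim!: eventually_mono)
    then show False using freq[OF x r(2)] by (simp add: frequently_def)
  qed
  have "AE x in lebesgue. x \<in> {0..1} \<longrightarrow> ereal \<mu> \<le> limsup (\<lambda>n. ereal (f x n))"
  proof (rule AE_I')
    show "{x \<in> {0..1}. \<not> (\<forall>K. \<exists>k\<ge>K. x \<in> farey_nbhd k)} \<in> null_sets lebesgue"
      using negligible_not_infinitely_often_farey_nbhd negligible_iff_null_sets by blast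
    show "{x \<in> space lebesgue. \<not> (x \<in> {0..1} \<longrightarrow> ereal \<mu> \<le> limsup (\<lambda>n. ereal (f x n)))}
        \<subseteq> {x \<in> {0..1}. \<not> (\<forall>K. \<exists>k\<ge>K. x \<in> farey_nbhd k)}"
      using main by blast
  qed
  then show ?thesis
    by (simp add: AE_restrict_space_iff f_def \<mu>_def)
qed

end
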